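(* Let $X,Y$ be compact networks. Then $X$ and $Y$ are Type II weakly isomorphic if and only if they are Type I weakly isomorphic, i.e. there exist a set $V$ and surjections $\varphi_X:V\to X$, $\varphi_Y:V\to Y$ such that $\omega_X(\varphi_X(v),\varphi_X(v'))=\omega_Y(\varphi_Y(v),\varphi_Y(v'))$ for all $v,v'\in V$.
   Context: A network is a pair $(X,\omega_X)$ with $X$ a first countable topological space and $\omega_X:X\times X\to\mathbb R$ continuous; it is compact if $X$ is compact. $X$ and $Y$ are Type II weakly isomorphic if for every $\varepsilon>0$ there exist a set $Z_\varepsilon$ and surjections $\phi_X:Z_\varepsilon\to X$, $\phi_Y:Z_\varepsilon\to Y$ with $|\omega_X(\phi_X(z),\phi_X(z'))-\omega_Y(\phi_Y(z),\phi_Y(z'))|<\varepsilon$ for all $z,z'\in Z_\varepsilon$. *)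

theory Defs
  imports "HOL-Analysis.Analysis"
begin

definition network :: "'a topology \<Rightarrow> ('a \<times> 'a \<Rightarrow> real) \<Rightarrow> bool" where
  "network X \<omega>X \<longleftrightarrow>
     first_countable X \<and> continuous_map (prod_topology X X) euclideanreal \<omega>X"

definition compact_network :: "'a topology \<Rightarrow> ('a \<times> 'a \<Rightarrow> real) \<Rightarrow> bool" where
  "compact_network X \<omega>X \<longleftrightarrow> network X \<omega>X \<and> compact_space X"

text \<open>
  HOL cannot quantify existentially over types, so the auxiliary sets below are taken in the
  type \<^typ>\<open>'a \<times> 'b\<close>. This is no restriction: an auxiliary set in an arbitrary type may be
  replaced by its image under \<open>z \<mapsto> (\<phi>X z, \<phi>Y z)\<close>, as proved in \<open>type_I_weakly_isomorphicI\<close>,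
  \<open>type_II_weakly_isomorphicI\<close> and, for a single \<open>\<epsilon>\<close>, \<open>type_II_weakly_isomorphic_witness\<close>.
\<close>

definition type_I_weakly_isomorphic ::
  "'a topology \<Rightarrow> ('a \<times> 'a \<Rightarrow> real) \<Rightarrow> 'b topology \<Rightarrow> ('b \<times> 'b \<Rightarrow> real) \<Rightarrow> bool" where
  "type_I_weakly_isomorphic X \<omega>X Y \<omega>Y \<longleftrightarrow>
     (\<exists>(V :: ('a \<times> 'b) set) \<phi>X \<phi>Y.
        \<phi>X ` V = topspace X \<and> \<phi>Y ` V = topspace Y \<and>
        (\<forall>v\<in>V. \<forall>v'\<in>V. \<omega>X (\<phi>X v, \<phi>X v') = \<omega>Y (\<phi>Y v, \<phi>Y v')))"

definition type_II_weakly_isomorphic ::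
  "'a topology \<Rightarrow> ('a \<times> 'a \<Rightarrow> real) \<Rightarrow> 'b topology \<Rightarrow> ('b \<times> 'b \<Rightarrow> real) \<Rightarrow> bool" where
  "type_II_weakly_isomorphic X \<omega>X Y \<omega>Y \<longleftrightarrow>
     (\<forall>\<epsilon>>0. \<exists>(Z :: ('a \<times> 'b) set) \<phi>X \<phi>Y.
        \<phi>X ` Z = topspace X \<and> \<phi>Y ` Z = topspace Y \<and>
        (\<forall>z\<in>Z. \<forall>z'\<in>Z. \<bar>\<omega>X (\<phi>X z, \<phi>X z') - \<omega>Y (\<phi>Y z, \<phi>Y z')\<bar> < \<epsilon>))"

lemma type_I_weakly_isomorphicI:
  fixes V :: "'c set"
  assumes "\<phi>X ` V = topspace X" "\<phi>Y ` V = topspace Y"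
    and "\<And>v v'. v \<in> V \<Longrightarrow> v' \<in> V \<Longrightarrow> \<omega>X (\<phi>X v, \<phi>X v') = \<omega>Y (\<phi>Y v, \<phi>Y v')"
  shows "type_I_weakly_isomorphic X \<omega>X Y \<omega>Y"
  unfolding type_I_weakly_isomorphic_def
proof (intro exI conjI)
  let ?V = "(\<lambda>v. (\<phi>X v, \<phi>Y v)) ` V"
  show "fst ` ?V = topspace X" "snd ` ?V = topspace Y"
    using assms(1,2) by (simp_all add: image_image)
  show "\<forall>v\<in>?V. \<forall>v'\<in>?V. \<omega>X (fst v, fst v') = \<omega>Y (snd v, snd v')"
    using assms(3) by simp
qed

lemma type_II_weakly_isomorphic_witness:
  fixes Z :: "'c set"
  assumes "\<phi>X ` Z = topspace X" "\<phi>Y ` Z = topspace Y"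
    and "\<And>z z'. z \<in> Z \<Longrightarrow> z' \<in> Z \<Longrightarrow> \<bar>\<omega>X (\<phi>X z, \<phi>X z') - \<omega>Y (\<phi>Y z, \<phi>Y z')\<bar> < \<epsilon>"
  shows "\<exists>(Z' :: ('a \<times> 'b) set) \<psi>X \<psi>Y.
     \<psi>X ` Z' = topspace (X :: 'a topology) \<and> \<psi>Y ` Z' = topspace (Y :: 'b topology) \<and>
     (\<forall>z\<in>Z'. \<forall>z'\<in>Z'. \<bar>\<omega>X (\<psi>X z, \<psi>X z') - \<omega>Y (\<psi>Y z, \<psi>Y z')\<bar> < \<epsilon>)"
proof (intro exI conjI)
  let ?Z = "(\<lambda>z. (\<phi>X z, \<phi>Y z)) ` Z"
  show "fst ` ?Z = topspace X" "snd ` ?Z = topspace Y"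
    using assms(1,2) by (simp_all add: image_image)
  show "\<forall>z\<in>?Z. \<forall>z'\<in>?Z. \<bar>\<omega>X (fst z, fst z') - \<omega>Y (snd z, snd z')\<bar> < \<epsilon>"
    using assms(3) by simp
qed

lemma type_II_weakly_isomorphicI:
  assumes "\<And>\<epsilon>. \<epsilon> > 0 \<Longrightarrow> \<exists>(Z :: 'c set) \<phi>X \<phi>Y.
     \<phi>X ` Z = topspace X \<and> \<phi>Y ` Z = topspace Y \<and>
     (\<forall>z\<in>Z. \<forall>z'\<in>Z. \<bar>\<omega>X (\<phi>X z, \<phi>X z') - \<omega>Y (\<phi>Y z, \<phi>Y z')\<bar> < \<epsilon>)"
  shows "type_II_weakly_isomorphic X \<omega>X Y \<omega>Y"
  unfolding type_II_weakly_isomorphic_def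
proof (intro allI impI)
  fix \<epsilon> :: real assume "\<epsilon> > 0"
  from assms[OF this] obtain Z :: "'c set" and \<phi>X \<phi>Y where
    1: "\<phi>X ` Z = topspace X" "\<phi>Y ` Z = topspace Y"
    and *: "\<forall>z\<in>Z. \<forall>z'\<in>Z. \<bar>\<omega>X (\<phi>X z, \<phi>X z') - \<omega>Y (\<phi>Y z, \<phi>Y z')\<bar> < \<epsilon>"
    by (elim exE conjE)
  from 1 show "\<exists>(Z :: ('a \<times> 'b) set) \<phi>X \<phi>Y.
     \<phi>X ` Z = topspace X \<and> \<phi>Y ` Z = topspace Y \<and>
     (\<forall>z\<in>Z. \<forall>z'\<in>Z. \<bar>\<omega>X (\<phi>X z, \<phi>X z') - \<omega>Y (\<phi>Y z, \<phi>Y z')\<bar> < \<epsilon>)"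
    by (rule type_II_weakly_isomorphic_witness) (use * in simp)
qed

end

theory Submission
  imports Defs
begin

text \<open>
  For each \<open>\<epsilon> > 0\<close>, an \<open>\<epsilon>\<close>-correspondence chooses a partner for every point of \<open>X\<close> and for every
  point of \<open>Y\<close>. Such choices are the points of a product of the compact spaces \<open>{x} \<times> Y\<close> and
  \<open>X \<times> {y}\<close>, which is compact by Tychonoff. The choices of distortion at most \<open>\<epsilon>\<close> form closed
  nonempty sets that shrink with \<open>\<epsilon>\<close>, so some choice has distortion zero.
\<close>

text \<open>For each pair \<open>i\<close>, \<open>j\<close> the condition cuts out the preimage of
  a closed interval under a continuous map, and any intersection of such preimages is
  closed.\<close>

lemma closedin_pairwise_abs_le:
  assumes "continuous_map (prod_topology Z Z) euclideanreal F"
    and "\<And>i. i \<in> I \<Longrightarrow> continuous_map P Z (\<lambda>h. h i)"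
  shows "closedin P {h \<in> topspace P. \<forall>i\<in>I. \<forall>j\<in>I. \<bar>F (h i, h j)\<bar> \<le> e}"
proof -
  have *: "closedin P {h \<in> topspace P. F (h i, h j) \<in> {-e..e}}" if "i \<in> I" "j \<in> I" for i j
  proof (rule closedin_continuous_map_preimage)
    show "continuous_map P euclideanreal (\<lambda>h. F (h i, h j))"
      using continuous_map_compose[OF _ assms(1), of P "\<lambda>h. (h i, h j)"] assms(2) that
      by (simp add: o_def continuous_map_pairedI)
  qed simp
  \<comment> \<open>Adding \<open>topspace P\<close> itself keeps the family nonempty when
    \<open>I\<close> is empty.\<close>
  have "{h \<in> topspace P. \<forall>i\<in>I. \<forall>j\<in>I. \<bar>F (h i, h j)\<bar> \<le> e} =
      \<Inter> (insert (topspace P)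
        ((\<lambda>(i, j). {h \<in> topspace P. F (h i, h j) \<in> {-e..e}}) ` (I \<times> I)))"
    by (auto simp: abs_le_iff minus_le_iff)
  also have "closedin P \<dots>"
    by (rule closedin_Inter) (use * in auto)
  finally show ?thesis .
qed

lemma type_II_imp_type_I_weakly_isomorphic:
  fixes X :: "'a topology" and Y :: "'b topology"
  assumes "compact_space X" "continuous_map (prod_topology X X) euclideanreal \<omega>X"
    and "compact_space Y" "continuous_map (prod_topology Y Y) euclideanreal \<omega>Y"
    and II: "type_II_weakly_isomorphic X \<omega>X Y \<omega>Y"
  shows "type_I_weakly_isomorphic X \<omega>X Y \<omega>Y"
proof -
  define Z where "Z = prod_topology X Y"
  define I where "I = topspace X <+> topspace Y"
  \<comment> \<open>A choice records the whole pair, with one component frozen by the index. Both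
    kinds of index thus take values in the one space \<open>Z\<close>, and the single function
    \<open>F\<close> compares any two of them.\<close>
  define C :: "'a + 'b \<Rightarrow> ('a \<times> 'b) set"
    where "C = case_sum (\<lambda>x. {x} \<times> topspace Y) (\<lambda>y. topspace X \<times> {y})"
  define P where "P = product_topology (\<lambda>i. subtopology Z (C i)) I"
  define F where "F = (\<lambda>u. \<omega>X (fst (fst u), fst (snd u)) - \<omega>Y (snd (fst u), snd (snd u)))"
  \<comment> \<open>The bound is weak, not strict, so that \<open>D n\<close> is closed.\<close>
  define D where "D = (\<lambda>n. {h \<in> topspace P. \<forall>i\<in>I. \<forall>j\<in>I. \<bar>F (h i, h j)\<bar> \<le> inverse (real (Suc n))})"
  have subI: "C i \<subseteq> topspace Z" if "i \<in> I" for i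
    using that by (auto simp: C_def Z_def I_def)
  have "compactin Z (C i)" if "i \<in> I" for i
    using that assms(1,3) by (auto simp: C_def Z_def I_def compactin_Times compact_space_def)
  then have "compact_space P"
    by (simp add: P_def compact_space_product_topology compact_space_subtopology)
  have topP: "topspace P = Pi\<^sub>E I C"
    unfolding P_def topspace_product_topology using subI
    by (intro PiE_cong) (simp add: inf.absorb2)
  have proj: "continuous_map P Z (\<lambda>h. h i)" if "i \<in> I" for i
    using continuous_map_product_projection[OF that, of "\<lambda>i. subtopology Z (C i)"]
    by (simp add: P_def continuous_map_in_subtopology)
  have fst_snd: "continuous_map Z X fst" "continuous_map Z Y snd"
    by (simp_all add: Z_def continuous_map_fst continuous_map_snd)
  have "continuous_map (prod_topology Z Z) (prod_topology X X) (\<lambda>u. (fst (fst u), fst (snd u)))"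
    "continuous_map (prod_topology Z Z) (prod_topology Y Y) (\<lambda>u. (snd (fst u), snd (snd u)))"
    by (intro continuous_map_pairedI continuous_map_compose[OF _ fst_snd(1), unfolded o_def]
        continuous_map_compose[OF _ fst_snd(2), unfolded o_def] continuous_map_fst continuous_map_snd)+
  from continuous_map_compose[OF this(1) assms(2)] continuous_map_compose[OF this(2) assms(4)]
  have contF: "continuous_map (prod_topology Z Z) euclideanreal F"
    by (simp add: F_def o_def continuous_map_diff)
  have "D n \<noteq> {}" for n
  proof -
    have "inverse (real (Suc n)) > 0"
      by simp
    with II obtain W :: "('a \<times> 'b) set" and f g where
      W: "f ` W = topspace X" "g ` W = topspace Y"
      and dist: "\<And>z z'. z \<in> W \<Longrightarrow> z' \<in> W \<Longrightarrow>
          \<bar>\<omega>X (f z, f z') - \<omega>Y (g z, g z')\<bar> < inverse (real (Suc n))"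
      unfolding type_II_weakly_isomorphic_def by metis
    \<comment> \<open>For \<open>Inl x\<close> take \<open>w\<close> with \<open>f w = x\<close>,
      for \<open>Inr y\<close> take \<open>w\<close> with \<open>g w = y\<close>; both exist by
      surjectivity.\<close>
    have "\<exists>w\<in>W. (f w, g w) \<in> C i" if "i \<in> I" for i
      using that by (cases i) (auto simp: I_def C_def simp flip: W)
    then obtain s where s: "\<And>i. i \<in> I \<Longrightarrow> s i \<in> W \<and> (f (s i), g (s i)) \<in> C i"
      by metis
    \<comment> \<open>The restriction to \<open>I\<close> makes the choice an extensional function,
      as points of \<open>P\<close> must be.\<close>
    have "(\<lambda>i\<in>I. (f (s i), g (s i))) \<in> D n"
      using s dist by (auto simp: D_def topP F_def less_imp_le)
    then show ?thesis
      by blast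
  qed
  moreover have "closedin P (D n)" for n
    unfolding D_def by (rule closedin_pairwise_abs_le[OF contF proj])
  moreover have "decseq D"
  proof (rule decseq_SucI)
    fix n
    have "inverse (real (Suc (Suc n))) \<le> inverse (real (Suc n))"
      by simp
    then show "D (Suc n) \<subseteq> D n"
      unfolding D_def by (smt (verit) Collect_mono)
  qed
  \<comment> \<open>Cantor's intersection theorem in the compact space \<open>P\<close>.\<close>
  ultimately have "(\<Inter>n. D n) \<noteq> {}"
    using \<open>compact_space P\<close> by (intro compact_space_imp_nest) auto
  then obtain h where h: "\<And>n. h \<in> D n"
    by blast
  have hC: "h i \<in> C i" if "i \<in> I" for i
    using h[of 0] that by (auto simp: D_def topP)
  have F0: "F (h i, h j) = 0" if "i \<in> I" "j \<in> I" for i j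
  proof (rule ccontr)
    assume "F (h i, h j) \<noteq> 0"
    then obtain n where "inverse (real (Suc n)) < \<bar>F (h i, h j)\<bar>"
      using reals_Archimedean[of "\<bar>F (h i, h j)\<bar>"] by auto
    with h[of n] that show False
      by (force simp: D_def)
  qed
  \<comment> \<open>The index set \<open>I\<close> itself serves as the auxiliary set. The
    coordinate of \<open>h\<close> at \<open>Inl x\<close> has first component \<open>x\<close> and
    the one at \<open>Inr y\<close> has second component \<open>y\<close>, which gives
    surjectivity.\<close>
  show ?thesis
  proof (rule type_I_weakly_isomorphicI)
    show "(fst \<circ> h) ` I = topspace X"
    proof (intro subset_antisym subsetI)
      fix x assume "x \<in> topspace X"
      then show "x \<in> (fst \<circ> h) ` I"
        using hC[of "Inl x"] by (intro image_eqI[of _ _ "Inl x"]) (auto simp: I_def C_def InlI InrI mem_Times_iff)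
    qed (use hC subI in \<open>force simp: Z_def\<close>)
    show "(snd \<circ> h) ` I = topspace Y"
    proof (intro subset_antisym subsetI)
      fix y assume "y \<in> topspace Y"
      then show "y \<in> (snd \<circ> h) ` I"
        using hC[of "Inr y"] by (intro image_eqI[of _ _ "Inr y"]) (auto simp: I_def C_def InlI InrI mem_Times_iff)
    qed (use hC subI in \<open>force simp: Z_def\<close>)
    show "\<omega>X ((fst \<circ> h) i, (fst \<circ> h) j) = \<omega>Y ((snd \<circ> h) i, (snd \<circ> h) j)"
      if "i \<in> I" "j \<in> I" for i j
      using F0[OF that] by (simp add: F_def)
  qed
qed

text \<open>One exact correspondence serves every \<open>\<epsilon>\<close>, since its distortion is
  zero.\<close>

lemma type_I_imp_type_II_weakly_isomorphic:
  assumes "type_I_weakly_isomorphic X \<omega>X Y \<omega>Y"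
  shows "type_II_weakly_isomorphic X \<omega>X Y \<omega>Y"
  using assms unfolding type_I_weakly_isomorphic_def type_II_weakly_isomorphic_def
  by (metis abs_zero diff_self)

theorem mainTheorem2:
  fixes X :: "'a topology" and \<omega>X :: "'a \<times> 'a \<Rightarrow> real"
    and Y :: "'b topology" and \<omega>Y :: "'b \<times> 'b \<Rightarrow> real"
  assumes "compact_network X \<omega>X" and "compact_network Y \<omega>Y"
  shows "type_II_weakly_isomorphic X \<omega>X Y \<omega>Y \<longleftrightarrow> type_I_weakly_isomorphic X \<omega>X Y \<omega>Y"
  using assms type_II_imp_type_I_weakly_isomorphic type_I_imp_type_II_weakly_isomorphic
  unfolding compact_network_def network_def by metis

end
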